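(* Let $\le_r$ be the relation obtained from the rules defining $\le$ by replacing the rule (conv) by the rule (red): from $T\to^*T'$, $T'\le U'$ and $U\to^* U'$ infer $T\le U$. Then $\le_r$ equals $\le$.
   Context: Sorts: $\mathcal S=\{\star,\Box\}$. Let $\mathcal X$ be a set of variables and $\mathcal F$ a set of symbols; a set $\mathcal R$ of rewrite rules is given, a symbol is defined if it heads the left-hand side of some rule and constant otherwise; $\mathcal{CF}^\Box$ denotes the constant symbols of sort $\Box$. Size expressions form a first-order term algebra $\mathcal A$ over size symbols and size variables, with a quasi-ordering $\le_{\mathcal A}$. Terms: $t::= s\mid x\mid C^a\mid f\mid [x:t]t\mid (x:t)t\mid tt$ with $s\in\mathcal S$, $C\in\mathcal{CF}^\Box$, $a\in\mathcal A$, $f\in\mathcal F\setminus\mathcal{CF}^\Box$. The reduction $\to$ is $\beta\cup\mathcal R$ closed under contexts and is assumed confluent; $\to^*$ is its reflexive-transitive closure and $T\downarrow U$ means $T$ and $U$ have a common reduct. Subtyping $\le$ is the smallest relation closed under: (refl) $T\le T$; (size) $C^a\vec t\le C^b\vec t$ when $C\in\mathcal{CF}^\Box$ and $a\le_{\mathcal A}b$; (prod) from $U'\le U$ and $V\le V'$ infer $(x:U)V\le(x:U')V'$; (conv) from $T'\le U'$, $T\downarrow T'$, $U'\downarrow U$ infer $T\le U$; (trans) from $T\le U$, $U\le V$ infer $T\le V$. *)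

theory Defs
  imports "HOL-Library.Confluence"
begin

datatype sort = Star | Box

text \<open>
  Size expressions are the well-formed terms of a first-order signature, given as a set
  \<open>Sg\<close> of pairs (size symbol, arity).
\<close>

datatype ('h, 'v) size_expr = SVar 'v | SFun 'h "('h, 'v) size_expr list"

inductive_set size_alg :: "('h \<times> nat) set \<Rightarrow> ('h, 'v) size_expr set"
  for Sg :: "('h \<times> nat) set" where
  "SVar v \<in> size_alg Sg"
| "(h, length as) \<in> Sg \<Longrightarrow> (\<And>a. a \<in> set as \<Longrightarrow> a \<in> size_alg Sg) \<Longrightarrow> SFun h as \<in> size_alg Sg"

text \<open>
  Term variables are de Bruijn indices, so that equality is \<open>\<alpha>\<close>-equivalence: \<open>Lam T t\<close> is
  \<open>[x:T]t\<close> and \<open>Pi T U\<close> is \<open>(x:T)U\<close>, with index 0 bound in \<open>t\<close> and in \<open>U\<close>.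
  \<open>Con C a\<close> is \<open>C\<close> annotated with the size \<open>a\<close>. Which symbols carry an annotation depends on
  the rewrite rules and is imposed by the set \<open>terms\<close> below.
\<close>

datatype ('f, 'h, 'v) trm =
    Srt sort
  | Var nat
  | Con 'f "('h, 'v) size_expr"
  | Sym 'f
  | Lam "('f, 'h, 'v) trm" "('f, 'h, 'v) trm"
  | Pi "('f, 'h, 'v) trm" "('f, 'h, 'v) trm"
  | App "('f, 'h, 'v) trm" "('f, 'h, 'v) trm"

abbreviation Apps :: "('f, 'h, 'v) trm \<Rightarrow> ('f, 'h, 'v) trm list \<Rightarrow> ('f, 'h, 'v) trm" where
  "Apps \<equiv> foldl App"

type_synonym ('f, 'h, 'v) rules = "(('f, 'h, 'v) trm \<times> ('f, 'h, 'v) trm) set"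

fun head_symbol :: "('f, 'h, 'v) trm \<Rightarrow> 'f option" where
  "head_symbol (Con C a) = Some C"
| "head_symbol (Sym f) = Some f"
| "head_symbol (App t u) = head_symbol t"
| "head_symbol _ = None"

definition defined_symbols :: "('f, 'h, 'v) rules \<Rightarrow> 'f set" where
  "defined_symbols R = {f. \<exists>(l, r) \<in> R. head_symbol l = Some f}"

definition const_box :: "'f set \<Rightarrow> ('f \<Rightarrow> sort) \<Rightarrow> ('f, 'h, 'v) rules \<Rightarrow> 'f set" where
  "const_box F srt R = {f \<in> F. f \<notin> defined_symbols R \<and> srt f = Box}"

inductive_set terms ::
  "('h \<times> nat) set \<Rightarrow> 'f set \<Rightarrow> ('f \<Rightarrow> sort) \<Rightarrow> ('f, 'h, 'v) rules \<Rightarrow> ('f, 'h, 'v) trm set"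
  for Sg F srt R where
  "Srt s \<in> terms Sg F srt R"
| "Var i \<in> terms Sg F srt R"
| "C \<in> const_box F srt R \<Longrightarrow> a \<in> size_alg Sg \<Longrightarrow> Con C a \<in> terms Sg F srt R"
| "f \<in> F - const_box F srt R \<Longrightarrow> Sym f \<in> terms Sg F srt R"
| "T \<in> terms Sg F srt R \<Longrightarrow> t \<in> terms Sg F srt R \<Longrightarrow> Lam T t \<in> terms Sg F srt R"
| "T \<in> terms Sg F srt R \<Longrightarrow> U \<in> terms Sg F srt R \<Longrightarrow> Pi T U \<in> terms Sg F srt R"
| "t \<in> terms Sg F srt R \<Longrightarrow> u \<in> terms Sg F srt R \<Longrightarrow> App t u \<in> terms Sg F srt R"

fun ren :: "(nat \<Rightarrow> nat) \<Rightarrow> ('f, 'h, 'v) trm \<Rightarrow> ('f, 'h, 'v) trm" where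
  "ren \<xi> (Srt s) = Srt s"
| "ren \<xi> (Var i) = Var (\<xi> i)"
| "ren \<xi> (Con C a) = Con C a"
| "ren \<xi> (Sym f) = Sym f"
| "ren \<xi> (Lam T t) = Lam (ren \<xi> T) (ren (case_nat 0 (Suc \<circ> \<xi>)) t)"
| "ren \<xi> (Pi T U) = Pi (ren \<xi> T) (ren (case_nat 0 (Suc \<circ> \<xi>)) U)"
| "ren \<xi> (App t u) = App (ren \<xi> t) (ren \<xi> u)"

definition lift_subst :: "(nat \<Rightarrow> ('f, 'h, 'v) trm) \<Rightarrow> nat \<Rightarrow> ('f, 'h, 'v) trm" where
  "lift_subst \<sigma> = case_nat (Var 0) (ren Suc \<circ> \<sigma>)"

fun subst :: "(nat \<Rightarrow> ('f, 'h, 'v) trm) \<Rightarrow> ('f, 'h, 'v) trm \<Rightarrow> ('f, 'h, 'v) trm" where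
  "subst \<sigma> (Srt s) = Srt s"
| "subst \<sigma> (Var i) = \<sigma> i"
| "subst \<sigma> (Con C a) = Con C a"
| "subst \<sigma> (Sym f) = Sym f"
| "subst \<sigma> (Lam T t) = Lam (subst \<sigma> T) (subst (lift_subst \<sigma>) t)"
| "subst \<sigma> (Pi T U) = Pi (subst \<sigma> T) (subst (lift_subst \<sigma>) U)"
| "subst \<sigma> (App t u) = App (subst \<sigma> t) (subst \<sigma> u)"

inductive step :: "('f, 'h, 'v) rules \<Rightarrow> ('f, 'h, 'v) trm \<Rightarrow> ('f, 'h, 'v) trm \<Rightarrow> bool"
  for R where
  beta: "step R (App (Lam T t) u) (subst (case_nat u Var) t)"
| rule: "(l, r) \<in> R \<Longrightarrow> step R (subst \<sigma> l) (subst \<sigma> r)"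
| LamL: "step R T T' \<Longrightarrow> step R (Lam T t) (Lam T' t)"
| LamR: "step R t t' \<Longrightarrow> step R (Lam T t) (Lam T t')"
| PiL: "step R T T' \<Longrightarrow> step R (Pi T U) (Pi T' U)"
| PiR: "step R U U' \<Longrightarrow> step R (Pi T U) (Pi T U')"
| AppL: "step R t t' \<Longrightarrow> step R (App t u) (App t' u)"
| AppR: "step R u u' \<Longrightarrow> step R (App t u) (App t u')"

text \<open>The reduction relation on (well-formed) terms.\<close>

definition red ::
  "('h \<times> nat) set \<Rightarrow> 'f set \<Rightarrow> ('f \<Rightarrow> sort) \<Rightarrow> ('f, 'h, 'v) rules
    \<Rightarrow> ('f, 'h, 'v) trm \<Rightarrow> ('f, 'h, 'v) trm \<Rightarrow> bool" where
  "red Sg F srt R t u \<longleftrightarrow> t \<in> terms Sg F srt R \<and> u \<in> terms Sg F srt R \<and> step R t u"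

definition joinable :: "('a \<Rightarrow> 'a \<Rightarrow> bool) \<Rightarrow> 'a \<Rightarrow> 'a \<Rightarrow> bool" where
  "joinable r t u \<longleftrightarrow> (\<exists>v. r\<^sup>*\<^sup>* t v \<and> r\<^sup>*\<^sup>* u v)"

text \<open>
  Both subtyping relations only relate elements of \<open>terms\<close>. In \<open>conv\<close> and \<open>red\<close> no side condition
  is needed for this: \<open>T'\<close> and \<open>U'\<close> are terms by induction, and a tree outside \<open>terms\<close> is related
  by the reflexive-transitive closure of \<open>red Sg F srt R\<close> to itself only.
\<close>

inductive sub ::
  "('h \<times> nat) set \<Rightarrow> 'f set \<Rightarrow> ('f \<Rightarrow> sort) \<Rightarrow> ('f, 'h, 'v) rules \<Rightarrow> ('h, 'v) size_expr rel
    \<Rightarrow> ('f, 'h, 'v) trm \<Rightarrow> ('f, 'h, 'v) trm \<Rightarrow> bool"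
  for Sg F srt R leA where
  refl: "T \<in> terms Sg F srt R \<Longrightarrow> sub Sg F srt R leA T T"
| size: "C \<in> const_box F srt R \<Longrightarrow> a \<in> size_alg Sg \<Longrightarrow> b \<in> size_alg Sg \<Longrightarrow> (a, b) \<in> leA \<Longrightarrow>
    set ts \<subseteq> terms Sg F srt R \<Longrightarrow>
    sub Sg F srt R leA (Apps (Con C a) ts) (Apps (Con C b) ts)"
| prod: "sub Sg F srt R leA U' U \<Longrightarrow> sub Sg F srt R leA V V' \<Longrightarrow>
    sub Sg F srt R leA (Pi U V) (Pi U' V')"
| conv: "sub Sg F srt R leA T' U' \<Longrightarrow> joinable (red Sg F srt R) T T' \<Longrightarrow>
    joinable (red Sg F srt R) U' U \<Longrightarrow> sub Sg F srt R leA T U"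
| trans: "sub Sg F srt R leA T U \<Longrightarrow> sub Sg F srt R leA U V \<Longrightarrow> sub Sg F srt R leA T V"

inductive sub_r ::
  "('h \<times> nat) set \<Rightarrow> 'f set \<Rightarrow> ('f \<Rightarrow> sort) \<Rightarrow> ('f, 'h, 'v) rules \<Rightarrow> ('h, 'v) size_expr rel
    \<Rightarrow> ('f, 'h, 'v) trm \<Rightarrow> ('f, 'h, 'v) trm \<Rightarrow> bool"
  for Sg F srt R leA where
  refl: "T \<in> terms Sg F srt R \<Longrightarrow> sub_r Sg F srt R leA T T"
| size: "C \<in> const_box F srt R \<Longrightarrow> a \<in> size_alg Sg \<Longrightarrow> b \<in> size_alg Sg \<Longrightarrow> (a, b) \<in> leA \<Longrightarrow>
    set ts \<subseteq> terms Sg F srt R \<Longrightarrow>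
    sub_r Sg F srt R leA (Apps (Con C a) ts) (Apps (Con C b) ts)"
| prod: "sub_r Sg F srt R leA U' U \<Longrightarrow> sub_r Sg F srt R leA V V' \<Longrightarrow>
    sub_r Sg F srt R leA (Pi U V) (Pi U' V')"
| red: "(red Sg F srt R)\<^sup>*\<^sup>* T T' \<Longrightarrow> sub_r Sg F srt R leA T' U' \<Longrightarrow>
    (red Sg F srt R)\<^sup>*\<^sup>* U U' \<Longrightarrow> sub_r Sg F srt R leA T U"
| trans: "sub_r Sg F srt R leA T U \<Longrightarrow> sub_r Sg F srt R leA U V \<Longrightarrow> sub_r Sg F srt R leA T V"

end

(* The rule (conv) is derivable in sub_r: if T and T' have the common reduct W, then (red) applied
   to W \<le> W gives T \<le> T', so transitivity links T \<le> T' \<le> U' \<le> U. Conversely,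
   (red) is the instance of (conv) in which a common reduct is T' itself, respectively U'. *)

theory Submission
  imports Defs
begin

lemma Apps_in_terms:
  assumes "t \<in> terms Sg F srt R" and "set ts \<subseteq> terms Sg F srt R"
  shows "Apps t ts \<in> terms Sg F srt R"
  using assms by (induction ts arbitrary: t) (auto intro: terms.intros)

text \<open>Each single \<open>red\<close> step has both ends in \<open>terms\<close>, and the empty
  reduction has equal ends; so membership travels in both directions.\<close>

lemma reds_terms_iff:
  assumes "(red Sg F srt R)\<^sup>*\<^sup>* t u"
  shows "t \<in> terms Sg F srt R \<longleftrightarrow> u \<in> terms Sg F srt R"
  using assms by (induction rule: rtranclp_induct) (auto simp: red_def)

lemma sub_r_terms:
  assumes "sub_r Sg F srt R leA T U"
  shows "T \<in> terms Sg F srt R \<and> U \<in> terms Sg F srt R"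
  using assms
  by (induction rule: sub_r.induct)
    (auto simp: reds_terms_iff intro: Apps_in_terms terms.intros)

lemma joinable_sym: "joinable r t u \<longleftrightarrow> joinable r u t"
  by (auto simp: joinable_def)

text \<open>Membership of \<open>T\<close> is assumed because a tree outside \<open>terms\<close> is
  joinable with itself by the empty reduction, yet \<open>sub_r\<close> does not relate it to
  anything.\<close>

lemma joinable_imp_sub_r:
  assumes "joinable (red Sg F srt R) T U" and "T \<in> terms Sg F srt R"
  shows "sub_r Sg F srt R leA T U"
proof -
  obtain W where T: "(red Sg F srt R)\<^sup>*\<^sup>* T W" and U: "(red Sg F srt R)\<^sup>*\<^sup>* U W"
    using assms(1) by (auto simp: joinable_def)
  have "W \<in> terms Sg F srt R"
    using reds_terms_iff[OF T] assms(2) by simp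
  then show ?thesis
    by (rule sub_r.red[OF T sub_r.refl U])
qed

lemma joinable_terms_iff:
  assumes "joinable (red Sg F srt R) T U"
  shows "T \<in> terms Sg F srt R \<longleftrightarrow> U \<in> terms Sg F srt R"
  using assms by (auto simp: joinable_def reds_terms_iff)

lemma reds_imp_joinable: "r\<^sup>*\<^sup>* t u \<Longrightarrow> joinable r t u"
  by (auto simp: joinable_def)

lemma sub_r_imp_sub:
  assumes "sub_r Sg F srt R leA T U"
  shows "sub Sg F srt R leA T U"
  using assms
proof (induction rule: sub_r.induct)
  case (red T T' U' U)
  \<comment> \<open>\<open>joinable_sym\<close> turns the reduction from \<open>U\<close> to
    \<open>U'\<close> into the orientation that \<open>sub.conv\<close> asks for.\<close>
  then show ?case
    by (meson sub.conv reds_imp_joinable joinable_sym)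
qed (blast intro: sub.intros)+

lemma sub_imp_sub_r:
  assumes "sub Sg F srt R leA T U"
  shows "sub_r Sg F srt R leA T U"
  using assms
proof (induction rule: sub.induct)
  case (conv T' U' T U)
  \<comment> \<open>These are the left ends of the two joinable pairs, as
    \<open>joinable_imp_sub_r\<close> requires. By induction \<open>T'\<close> and \<open>U'\<close>
    are \<open>sub_r\<close>-related, hence terms; \<open>T\<close> inherits this from
    \<open>T'\<close>.\<close>
  then have "T \<in> terms Sg F srt R" "U' \<in> terms Sg F srt R"
    using joinable_terms_iff sub_r_terms by blast+
  then show ?case
    using conv by (meson joinable_imp_sub_r sub_r.trans)
qed (blast intro: sub_r.intros)+

theorem mainTheorem4:
  fixes Sg :: "('h \<times> nat) set"
    and F :: "'f set"
    and srt :: "'f \<Rightarrow> sort"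
    and R :: "('f, 'h, 'v) rules"
    and leA :: "('h, 'v) size_expr rel"
  assumes "R \<subseteq> terms Sg F srt R \<times> terms Sg F srt R"
    and "preorder_on (size_alg Sg) leA"
    and "confluentp (red Sg F srt R)"
  shows "sub_r Sg F srt R leA = sub Sg F srt R leA"
  by (intro ext iffI) (simp_all add: sub_r_imp_sub sub_imp_sub_r)

end
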